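(* Let $\Gamma_v=(G,v)$ be a one-step game with $N$ players, $v\in\mathbb{R}^N$, and let $\varepsilon\ge 0$. Then the following hold: 1. If $p\in[0,1]^N$ is $\varepsilon$-perfect for $\Gamma_v$, then $p$ is an $\varepsilon$-equilibrium in $\Gamma_v$. 2. If $p\in[0,1]^N$ is an $\varepsilon$-equilibrium in $\Gamma_v$, then $p$ is $\varepsilon\xi_p$-perfect for $\Gamma_v$, where $$\xi_p:=\max_{n\in\mathcal{N}}\xi_p^n,\qquad \xi_p^n:=\begin{cases}\max\left(\frac{1}{p^n},\frac{1}{1-p^n}\right)&\text{for }p^n\in(0,1),\\ 1&\text{for }p^n\in\{0,1\}.\end{cases}$$
   Context: A quitting game is a tuple $G=(\mathcal{N},(r_S)_{\emptyset\subseteq S\subseteq\mathcal{N}})$, where $\mathcal{N}=\{1,\dots,N\}$ is a finite set of players and $r_S=(r_S^1,\dots,r_S^N)^T\in\mathbb{R}^N$ is the payoff vector when exactly the players in $S$ quit, with $r_\emptyset=(0,\dots,0)^T$. For $v=(v^1,\dots,v^N)^T\in\mathbb{R}^N$, the one-step game $\Gamma_v=(G,v)$ is the one-stage game in which each player chooses continue (action $0$) or quit (action $1$); the payoff vector is $v$ if nobody quits and $r_S$ if $S\ne\emptyset$ is the set of quitting players. A strategy profile in $\Gamma_v$ is a vector $p=(p^1,\dots,p^N)^T\in[0,1]^N$, where $p^n$ is the probability that player $n$ quits (players act independently). For $S\subseteq\mathcal{N}$ put $\varrho(p,S):=\prod_{n\in S}p^n\prod_{m\in\mathcal{N}\setminus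 S}(1-p^m)$. The expected payoff is $\gamma_v(p)=(\gamma_v^1(p),\dots,\gamma_v^N(p))^T:=\varrho(p,\emptyset)\,v+\sum_{S\subseteq\mathcal{N}}\varrho(p,S)\,r_S$. For $b\in[0,1]$, $(p^{-n},b)$ denotes the profile obtained from $p$ by replacing the $n$-th component by $b$. $p$ is an $\varepsilon$-equilibrium in $\Gamma_v$ if for all $n\in\mathcal{N}$ and all $\tilde p^n\in[0,1]$: $\gamma_v^n(p)\ge\gamma_v^n((p^{-n},\tilde p^n))-\varepsilon$. An action $b\in\{0,1\}$ of player $n$ is an $\varepsilon$-best reply for $p^{-n}$ if $\gamma_v^n((p^{-n},b))\ge\max_{\tilde b\in\{0,1\}}\gamma_v^n((p^{-n},\tilde b))-\varepsilon$. Let $supp(x)=\{0\}$ if $x=0$, $\{0,1\}$ if $x\in(0,1)$, $\{1\}$ if $x=1$. $p$ is $\varepsilon$-perfect for $\Gamma_v$ if for every $n\in\mathcal{N}$ every action $b\in supp(p^n)$ is an $\varepsilon$-best reply for $p^{-n}$. *)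

theory Defs
  imports "HOL-Analysis.Analysis"
begin

text \<open>
  The players are the elements of an arbitrary finite (hence nonempty) type \<open>'n\<close>, with
  \<open>N = CARD('n)\<close>. A quitting game is given by its payoff vectors: \<open>r S\<close> is the payoff vector
  when exactly the players in \<open>S\<close> quit. The one-step game is the pair of \<open>r\<close> and the
  continuation payoff \<open>v\<close>.
\<close>

definition quitting_game :: "('n::finite set \<Rightarrow> real ^ 'n) \<Rightarrow> bool" where
  "quitting_game r \<longleftrightarrow> r {} = 0"

definition strategy_profile :: "real ^ 'n::finite \<Rightarrow> bool" where
  "strategy_profile p \<longleftrightarrow> (\<forall>n. p $ n \<in> {0..1})"

definition quit_prob :: "real ^ 'n::finite \<Rightarrow> 'n set \<Rightarrow> real" where
  "quit_prob p S = (\<Prod>n\<in>S. p $ n) * (\<Prod>m\<in>UNIV - S. 1 - p $ m)"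

text \<open>
  The sum includes \<open>S = {}\<close>, whose term vanishes in a quitting game because \<open>r {} = 0\<close>.
\<close>

definition payoff ::
    "('n::finite set \<Rightarrow> real ^ 'n) \<Rightarrow> real ^ 'n \<Rightarrow> real ^ 'n \<Rightarrow> real ^ 'n" where
  "payoff r v p = quit_prob p {} *\<^sub>R v + (\<Sum>S\<in>UNIV. quit_prob p S *\<^sub>R r S)"

definition replace :: "real ^ 'n::finite \<Rightarrow> 'n \<Rightarrow> real \<Rightarrow> real ^ 'n" where
  "replace p n b = (\<chi> i. if i = n then b else p $ i)"

definition eps_equilibrium ::
    "('n::finite set \<Rightarrow> real ^ 'n) \<Rightarrow> real ^ 'n \<Rightarrow> real \<Rightarrow> real ^ 'n \<Rightarrow> bool" where
  "eps_equilibrium r v \<epsilon> p \<longleftrightarrow>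
     (\<forall>n. \<forall>q\<in>{0..1}. payoff r v p $ n \<ge> payoff r v (replace p n q) $ n - \<epsilon>)"

text \<open>
  The actions continue and quit are the real numbers 0 and 1, identified with the
  corresponding pure strategies. The \<open>n\<close>-th component of \<open>p\<close> is irrelevant below.
\<close>

definition eps_best_reply ::
    "('n::finite set \<Rightarrow> real ^ 'n) \<Rightarrow> real ^ 'n \<Rightarrow> real \<Rightarrow> real ^ 'n \<Rightarrow> 'n \<Rightarrow> real \<Rightarrow> bool" where
  "eps_best_reply r v \<epsilon> p n b \<longleftrightarrow> b \<in> {0, 1} \<and>
     payoff r v (replace p n b) $ n
       \<ge> Max ((\<lambda>b'. payoff r v (replace p n b') $ n) ` {0, 1}) - \<epsilon>"

text \<open>Only meaningful for arguments in \<open>[0, 1]\<close>.\<close>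

definition supp :: "real \<Rightarrow> real set" where
  "supp x = (if x = 0 then {0} else if x = 1 then {1} else {0, 1})"

definition eps_perfect ::
    "('n::finite set \<Rightarrow> real ^ 'n) \<Rightarrow> real ^ 'n \<Rightarrow> real \<Rightarrow> real ^ 'n \<Rightarrow> bool" where
  "eps_perfect r v \<epsilon> p \<longleftrightarrow> (\<forall>n. \<forall>b\<in>supp (p $ n). eps_best_reply r v \<epsilon> p n b)"

definition xi_player :: "real ^ 'n::finite \<Rightarrow> 'n \<Rightarrow> real" where
  "xi_player p n =
     (if p $ n \<in> {0<..<1} then max (1 / (p $ n)) (1 / (1 - p $ n)) else 1)"

definition xi :: "real ^ 'n::finite \<Rightarrow> real" where
  "xi p = Max (range (xi_player p))"

end

theory Submission
  imports Defs
begin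

text \<open>
  Given the other players' strategies, the payoff of player \<open>n\<close> is the affine function
  \<open>(1 - q) * A + q * B\<close> of the own quitting probability \<open>q\<close>, where \<open>A\<close> and \<open>B\<close> are the payoffs
  for continuing and quitting. Hence deviating to a pure action is optimal, which gives the
  first part, while the gain from deviating to quitting is \<open>(1 - p $ n) * (B - A)\<close> and the gain
  from deviating to continuing is \<open>p $ n * (A - B)\<close>. Dividing these gains by the weights gives
  the second part.
\<close>

lemma replace_nth [simp]: "replace p n b $ i = (if i = n then b else p $ i)"
  by (simp add: replace_def)

lemma replace_same [simp]: "replace p n (p $ n) = p"
  by (simp add: vec_eq_iff)

text \<open>Splitting off the factor of player \<open>n\<close> leaves a product free of
  \<open>q\<close>, so the dependence on \<open>q\<close> is visibly affine.\<close>

lemma quit_prob_replace: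
  "quit_prob (replace p n q) S =
     (if n \<in> S then q else 1 - q) *
     ((\<Prod>i\<in>S - {n}. p $ i) * (\<Prod>i\<in>UNIV - S - {n}. 1 - p $ i))"
proof (cases "n \<in> S")
  case True
  have "(\<Prod>i\<in>S. replace p n q $ i) = q * (\<Prod>i\<in>S - {n}. p $ i)"
    using True by (subst prod.remove[of S n]) auto
  moreover have "(\<Prod>i\<in>UNIV - S. 1 - replace p n q $ i) = (\<Prod>i\<in>UNIV - S - {n}. 1 - p $ i)"
    using True by (intro prod.cong) auto
  ultimately show ?thesis
    using True by (simp add: quit_prob_def)
next
  case False
  have "(\<Prod>i\<in>UNIV - S. 1 - replace p n q $ i) = (1 - q) * (\<Prod>i\<in>UNIV - S - {n}. 1 - p $ i)"
    using False by (subst prod.remove[of "UNIV - S" n]) auto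
  moreover have "(\<Prod>i\<in>S. replace p n q $ i) = (\<Prod>i\<in>S - {n}. p $ i)"
    using False by (intro prod.cong) auto
  ultimately show ?thesis
    using False by (simp add: quit_prob_def)
qed

lemma quit_prob_replace_affine:
  "quit_prob (replace p n q) S =
     (1 - q) * quit_prob (replace p n 0) S + q * quit_prob (replace p n 1) S"
  by (simp add: quit_prob_replace)

lemma payoff_replace_affine:
  "payoff r v (replace p n q) =
     (1 - q) *\<^sub>R payoff r v (replace p n 0) + q *\<^sub>R payoff r v (replace p n 1)"
  unfolding payoff_def quit_prob_replace_affine[of p n q]
  by (simp add: scaleR_add_left scaleR_add_right scaleR_sum_right sum.distrib)

lemma payoff_replace_nth:
  "payoff r v (replace p n q) $ n =
     (1 - q) * payoff r v (replace p n 0) $ n + q * payoff r v (replace p n 1) $ n"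
  by (subst payoff_replace_affine) simp

text \<open>The profile \<open>p\<close> is its own replacement at \<open>q = p $ n\<close>, so the
  payoff without deviation lies on the same affine function.\<close>

lemma payoff_nth:
  "payoff r v p $ n =
     (1 - p $ n) * payoff r v (replace p n 0) $ n + p $ n * payoff r v (replace p n 1) $ n"
  using payoff_replace_nth[of r v p n "p $ n"] by simp

lemma eps_best_reply_iff:
  "eps_best_reply r v \<epsilon> p n b \<longleftrightarrow> b \<in> {0, 1} \<and>
     payoff r v (replace p n 0) $ n \<le> payoff r v (replace p n b) $ n + \<epsilon> \<and>
     payoff r v (replace p n 1) $ n \<le> payoff r v (replace p n b) $ n + \<epsilon>"
  by (auto simp: eps_best_reply_def)

lemma eps_best_reply_mono:
  "eps_best_reply r v \<epsilon> p n b \<Longrightarrow> \<epsilon> \<le> \<delta> \<Longrightarrow> eps_best_reply r v \<delta> p n b"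
  by (auto simp: eps_best_reply_def)

lemma xi_player_le_xi: "xi_player p n \<le> xi p"
  by (simp add: xi_def)

text \<open>Each action in the support pays at least \<open>max A B - \<epsilon>\<close>, hence so
  does their mixture, while no deviation pays more than \<open>max A B\<close>.\<close>

lemma eps_perfect_imp_eps_equilibrium:
  assumes p: "strategy_profile p" and perf: "eps_perfect r v \<epsilon> p"
  shows "eps_equilibrium r v \<epsilon> p"
  unfolding eps_equilibrium_def
proof (intro allI ballI)
  fix n and q :: real
  assume q: "q \<in> {0..1}"
  define A B x where "A = payoff r v (replace p n 0) $ n"
    and "B = payoff r v (replace p n 1) $ n" and "x = p $ n"
  have x: "0 \<le> x" "x \<le> 1"
    using p by (auto simp: strategy_profile_def x_def)
  have best: "eps_best_reply r v \<epsilon> p n b" if "b \<in> supp x" for b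
    using perf that by (simp add: eps_perfect_def x_def)
  have A: "max A B - \<epsilon> \<le> A" if "x \<noteq> 1"
  proof -
    have "0 \<in> supp x"
      using that by (simp add: supp_def)
    then show ?thesis
      using best[of 0] by (auto simp: eps_best_reply_iff A_def B_def)
  qed
  have B: "max A B - \<epsilon> \<le> B" if "x \<noteq> 0"
  proof -
    have "1 \<in> supp x"
      using that by (simp add: supp_def)
    then show ?thesis
      using best[of 1] by (auto simp: eps_best_reply_iff A_def B_def)
  qed
  have "(1 - q) * A + q * B \<le> max A B"
    using q by (intro convex_bound_le) auto
  \<comment> \<open>If \<open>x = 1\<close>, continuing is outside the support and \<open>A\<close>
    is not controlled, but its weight vanishes.\<close>
  moreover have "(1 - x) * (max A B - \<epsilon>) \<le> (1 - x) * A"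
    using A x by (cases "x = 1") (auto intro: mult_left_mono)
  moreover have "x * (max A B - \<epsilon>) \<le> x * B"
    using B x by (cases "x = 0") (auto intro: mult_left_mono)
  ultimately have "(1 - q) * A + q * B - \<epsilon> \<le> (1 - x) * A + x * B"
    by (simp add: algebra_simps)
  then show "payoff r v (replace p n q) $ n - \<epsilon> \<le> payoff r v p $ n"
    by (simp add: payoff_replace_nth[of r v p n q] payoff_nth[of r v p n] A_def B_def x_def)
qed

text \<open>An equilibrium bounds the regret of an action only after multiplication by its
  probability; the factor \<open>xi p\<close> absorbs the division by that probability.\<close>

lemma eps_equilibrium_imp_eps_perfect:
  assumes p: "strategy_profile p" and eps: "0 \<le> \<epsilon>" and eq: "eps_equilibrium r v \<epsilon> p"
  shows "eps_perfect r v (\<epsilon> * xi p) p"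
  unfolding eps_perfect_def
proof (intro allI ballI)
  fix n b
  assume b: "b \<in> supp (p $ n)"
  define A B x where "A = payoff r v (replace p n 0) $ n"
    and "B = payoff r v (replace p n 1) $ n" and "x = p $ n"
  have x: "0 \<le> x" "x \<le> 1"
    using p by (auto simp: strategy_profile_def x_def)
  have dev: "payoff r v (replace p n q) $ n - \<epsilon> \<le> (1 - x) * A + x * B" if "q \<in> {0..1}" for q
    using eq that payoff_nth[of r v p n]
    unfolding eps_equilibrium_def A_def B_def x_def by metis
  have gain_continue: "x * (A - B) \<le> \<epsilon>" and gain_quit: "(1 - x) * (B - A) \<le> \<epsilon>"
    using dev[of 0] dev[of 1] by (auto simp: A_def B_def algebra_simps)
  \<comment> \<open>A best reply is also compared with itself, which requires a nonnegative
    tolerance.\<close>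
  have "0 \<le> \<epsilon> * xi_player p n"
    using eps x by (auto simp: xi_player_def x_def intro!: mult_nonneg_nonneg max.coboundedI1)
  moreover have "B - A \<le> \<epsilon> * xi_player p n" if "x \<noteq> 1"
  proof -
    \<comment> \<open>For \<open>x = 0\<close> the left side is 1, exactly the value of
      \<open>xi_player\<close> at pure strategies. The bound \<open>1 / x\<close> below behaves in
      the same way at \<open>x = 1\<close>.\<close>
    have "1 / (1 - x) \<le> xi_player p n"
      using that x by (auto simp: xi_player_def x_def)
    then have "\<epsilon> / (1 - x) \<le> \<epsilon> * xi_player p n"
      using eps mult_left_mono by fastforce
    moreover have "B - A \<le> \<epsilon> / (1 - x)"
      using gain_quit that x by (simp add: pos_le_divide_eq mult.commute)
    ultimately show ?thesis by linarith
  qed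
  moreover have "A - B \<le> \<epsilon> * xi_player p n" if "x \<noteq> 0"
  proof -
    have "1 / x \<le> xi_player p n"
      using that x by (auto simp: xi_player_def x_def)
    then have "\<epsilon> / x \<le> \<epsilon> * xi_player p n"
      using eps mult_left_mono by fastforce
    moreover have "A - B \<le> \<epsilon> / x"
      using gain_continue that x by (simp add: pos_le_divide_eq mult.commute)
    ultimately show ?thesis by linarith
  qed
  ultimately have "eps_best_reply r v (\<epsilon> * xi_player p n) p n b"
    using b by (auto simp: eps_best_reply_iff supp_def A_def B_def x_def split: if_splits)
  \<comment> \<open>Since \<open>\<epsilon>\<close> is nonnegative, passing to the maximum over all
    players only enlarges the tolerance.\<close>
  then show "eps_best_reply r v (\<epsilon> * xi p) p n b"
    by (rule eps_best_reply_mono) (intro mult_left_mono xi_player_le_xi eps)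
qed

theorem theorem2p12:
  fixes r :: "'n::finite set \<Rightarrow> real ^ 'n" and v :: "real ^ 'n" and \<epsilon> :: real
  assumes "quitting_game r"
    and "\<epsilon> \<ge> 0"
  shows "(\<forall>p. strategy_profile p \<longrightarrow> eps_perfect r v \<epsilon> p \<longrightarrow> eps_equilibrium r v \<epsilon> p) \<and>
         (\<forall>p. strategy_profile p \<longrightarrow> eps_equilibrium r v \<epsilon> p \<longrightarrow> eps_perfect r v (\<epsilon> * xi p) p)"
  using assms(2) eps_perfect_imp_eps_equilibrium eps_equilibrium_imp_eps_perfect by blast

end
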